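(* The online moving knife procedure is forward proportional, immediately envy free, weakly truthful, surjective, scale invariant and sequential. However, it is not proportional, not envy free, not forward envy free, not equitable, not Pareto optimal, not weakly Pareto optimal, not truthful and not order monotonic.
   Context: Cake and valuations. The cake is the unit interval $[0,1]$. A piece is a finite union of subintervals; pieces given to different players overlap in at most finitely many points. Each player has a valuation function $v$ assigning a finite non-negative real value to each piece; $v$ is additive over pieces overlapping in finitely many points, continuous (the value of $[a,b]$ depends continuously on $a,b$), and $v([0,1])>0$. Valuations are not required to be normalized. There are $n$ players arriving one after another in a given order; $n$ is known to all players. Players do not know each other's valuations and are risk averse: they maximize the minimum value they will receive regardless of what the other players do. Online moving knife procedure (with parameter $k$, $2\le k<n$). The first $k$ players to arrive perform one round of a moving knife procedure: a knife is moved from left to right across the remaining cake, and as soon as one of the players present calls "cut", the cake is cut at the knife, that player takes the slice to the left of the knife and departs (simultaneous calls are resolved by a fixed rule depending only on the arrival order). If not all players have arrived, the next player arrives and a new round is performed on the remaining cake with the $k$ players present. Once all players have arrived, rounds continue with the remaining players (first $k-1$ of them, then one fewer after each round) until one player is left, who takes whatever remains. Truthful (risk averse) behaviour: when $j>1$ players are still to be allocated cake (whether or not they have arrived), each player present calls "cut" as soon as the slice to the left of the knife is worth $\frac1j$ of their value for the cake remaining at the start of the round. The outcome of the procedure is the outcome when all players behave this way. Convention: the procedure has a property if the property holds for all $n,k$ with $2\le k<n$ and all valuation functions of the players; it does not have the property if it fails for some such $n,k$ and some valuation functions. Properties. Proportional: each player assigns to their own piece at least $\frac1n$ of their value for the whole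 cake. Forward proportional: each player assigns to their own piece at least $\frac{r}{n-d}$ of their value for the whole cake, where $r$ is the fraction of the total value that this player assigns to the cake remaining when they arrive, and $d$ is the number of players who have already departed at that point. Envy free: no player values another player's piece more than their own. Forward envy free: no player values the piece allocated to any other player after their own arrival more than their own piece. Immediately envy free: no player values the piece allocated to any other player after their own arrival and before their own departure more than their own piece. Equitable: all players assign the same value to their own pieces. Pareto optimal: there is no other allocation of pieces to players that is strictly more valuable for one player and at least as valuable for all the others. Weakly Pareto optimal: there is no other allocation of pieces to players that is strictly more valuable for every player. Weakly truthful: for every player and every situation this player may face on arrival, the minimum (infimum) value that truthful behaviour guarantees them, over everything the other players may do, is at least that guaranteed by any other strategy. Truthful: there are no valuations for which some player gets a piece of strictly greater value (to them) by deviating from truthful behaviour while all others behave truthfully. Surjective: for every partition of $[0,1]$ into $n$ consecutive slices of positive length there are valuation functions for the players such that the procedure allocates exactly these slices, one to each player (it does not matter which player gets which slice). Scale invariant: the allocation is unchanged when a player's valuation is multiplied by a positive constant. Sequential: any slice given to a player lies to the left of any slice given to a player who departs later. Order monotonic: a player's value for their own piece does not decrease when that player is moved earlier in the arrival order, the relative arrival order of all other players being unchanged. *)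

theory Defs
  imports "HOL-Analysis.Analysis"
begin

definition piece :: "real set \<Rightarrow> bool" where
  "piece P \<longleftrightarrow> (\<exists>F. finite F \<and> (\<forall>I\<in>F. is_interval I \<and> I \<subseteq> {0..1}) \<and> P = \<Union>F)"

text \<open>Only the values of a valuation on pieces are meaningful.\<close>

definition valuation :: "(real set \<Rightarrow> real) \<Rightarrow> bool" where
  "valuation v \<longleftrightarrow>
     (\<forall>P. piece P \<longrightarrow> 0 \<le> v P) \<and>
     (\<forall>P Q. piece P \<and> piece Q \<and> finite (P \<inter> Q) \<longrightarrow> v (P \<union> Q) = v P + v Q) \<and>
     continuous_on {(a, b). 0 \<le> a \<and> a \<le> b \<and> b \<le> 1} (\<lambda>(a, b). v {a..b}) \<and>
     0 < v {0..1}"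

text \<open>
  Players are identified with their positions \<open>0, \<dots>, n - 1\<close> in the arrival order.
  A history lists the completed rounds, oldest first; every round records what is publicly
  observed: who called simultaneously, who got the slice, and its right end.
\<close>

datatype knife_round = Round (callers: "nat set") (taker: nat) (cut_pos: real)

type_synonym history = "knife_round list"

definition start :: "history \<Rightarrow> real" where
  "start h = (if h = [] then 0 else cut_pos (last h))"

definition present :: "nat \<Rightarrow> nat \<Rightarrow> history \<Rightarrow> nat set" where
  "present n k h = {..<min n (k + length h)} - taker ` set h"

text \<open>
  A strategy tells at which knife position a player calls in the next round, provided nobody
  has called before. Somebody has to call before the knife leaves the cake, so a player who does
  not want to call at all is taken to call at the right end.
\<close>

type_synonym strat = "history \<Rightarrow> real"

definition strategy :: "strat \<Rightarrow> bool" where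
  "strategy \<sigma> \<longleftrightarrow> (\<forall>h. start h \<in> {0..1} \<longrightarrow> \<sigma> h \<in> {start h..1})"

text \<open>
  A tie rule selects one of the simultaneous callers \<open>C\<close> among the players \<open>P\<close> present;
  since players are arrival positions, it depends on the arrival order only.
\<close>

type_synonym tie = "nat set \<Rightarrow> nat set \<Rightarrow> nat"

definition tie_rule :: "tie \<Rightarrow> bool" where
  "tie_rule \<tau> \<longleftrightarrow> (\<forall>P C. finite P \<and> C \<subseteq> P \<and> C \<noteq> {} \<longrightarrow> \<tau> P C \<in> C)"

definition next_round :: "tie \<Rightarrow> nat \<Rightarrow> nat \<Rightarrow> (nat \<Rightarrow> strat) \<Rightarrow> history \<Rightarrow> knife_round" where
  "next_round \<tau> n k S h =
     (let P = present n k h in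
      if is_singleton P then Round P (the_elem P) 1
      else let c = Min ((\<lambda>i. S i h) ` P); C = {i \<in> P. S i h = c} in Round C (\<tau> P C) c)"

primrec rounds :: "tie \<Rightarrow> nat \<Rightarrow> nat \<Rightarrow> (nat \<Rightarrow> strat) \<Rightarrow> nat \<Rightarrow> history" where
  "rounds \<tau> n k S 0 = []"
| "rounds \<tau> n k S (Suc m) = rounds \<tau> n k S m @ [next_round \<tau> n k S (rounds \<tau> n k S m)]"

abbreviation play :: "tie \<Rightarrow> nat \<Rightarrow> nat \<Rightarrow> (nat \<Rightarrow> strat) \<Rightarrow> history" where
  "play \<tau> n k S \<equiv> rounds \<tau> n k S n"

text \<open>Rounds are numbered from 0, so this is also the number of players who departed earlier.\<close>

definition departure :: "history \<Rightarrow> nat \<Rightarrow> nat" where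
  "departure H i = (THE m. m < length H \<and> taker (H ! m) = i)"

definition slice :: "history \<Rightarrow> nat \<Rightarrow> real set" where
  "slice H m = {start (take m H)..cut_pos (H ! m)}"

definition share :: "history \<Rightarrow> nat \<Rightarrow> real set" where
  "share H i = slice H (departure H i)"

text \<open>
  Number of rounds completed (players departed) when player \<open>i\<close> arrives; truncated subtraction
  gives 0 for the first \<open>k\<close> players.
\<close>

definition arrival :: "nat \<Rightarrow> nat \<Rightarrow> nat" where
  "arrival k i = i + 1 - k"

definition truthful_strat :: "nat \<Rightarrow> (real set \<Rightarrow> real) \<Rightarrow> strat" where
  "truthful_strat n v h =
     Inf {t \<in> {start h..1}. v {start h..t} \<ge> v {start h..1} / real (n - length h)}"

definition truthful_profile :: "nat \<Rightarrow> (nat \<Rightarrow> real set \<Rightarrow> real) \<Rightarrow> nat \<Rightarrow> strat" where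
  "truthful_profile n V i = truthful_strat n (V i)"

definition outcome :: "tie \<Rightarrow> nat \<Rightarrow> nat \<Rightarrow> (nat \<Rightarrow> real set \<Rightarrow> real) \<Rightarrow> history" where
  "outcome \<tau> n k V = play \<tau> n k (truthful_profile n V)"

definition setting :: "nat \<Rightarrow> nat \<Rightarrow> (nat \<Rightarrow> real set \<Rightarrow> real) \<Rightarrow> bool" where
  "setting n k V \<longleftrightarrow> 2 \<le> k \<and> k < n \<and> (\<forall>i<n. valuation (V i))"

definition proportional :: "tie \<Rightarrow> bool" where
  "proportional \<tau> \<longleftrightarrow> (\<forall>n k V. setting n k V \<longrightarrow>
     (\<forall>i<n. V i (share (outcome \<tau> n k V) i) \<ge> 1 / real n * V i {0..1}))"

definition forward_proportional :: "tie \<Rightarrow> bool" where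
  "forward_proportional \<tau> \<longleftrightarrow> (\<forall>n k V. setting n k V \<longrightarrow>
     (\<forall>i<n. let H = outcome \<tau> n k V; d = arrival k i;
                r = V i {start (take d H)..1} / V i {0..1}
             in V i (share H i) \<ge> r / real (n - d) * V i {0..1}))"

definition envy_free :: "tie \<Rightarrow> bool" where
  "envy_free \<tau> \<longleftrightarrow> (\<forall>n k V. setting n k V \<longrightarrow>
     (let H = outcome \<tau> n k V in
      \<forall>i<n. \<forall>j<n. V i (share H j) \<le> V i (share H i)))"

definition forward_envy_free :: "tie \<Rightarrow> bool" where
  "forward_envy_free \<tau> \<longleftrightarrow> (\<forall>n k V. setting n k V \<longrightarrow>
     (let H = outcome \<tau> n k V in
      \<forall>i<n. \<forall>j<n. arrival k i \<le> departure H j \<longrightarrow> V i (share H j) \<le> V i (share H i)))"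

definition immediately_envy_free :: "tie \<Rightarrow> bool" where
  "immediately_envy_free \<tau> \<longleftrightarrow> (\<forall>n k V. setting n k V \<longrightarrow>
     (let H = outcome \<tau> n k V in
      \<forall>i<n. \<forall>j<n. arrival k i \<le> departure H j \<and> departure H j < departure H i
        \<longrightarrow> V i (share H j) \<le> V i (share H i)))"

definition equitable :: "tie \<Rightarrow> bool" where
  "equitable \<tau> \<longleftrightarrow> (\<forall>n k V. setting n k V \<longrightarrow>
     (let H = outcome \<tau> n k V in
      \<forall>i<n. \<forall>j<n. V i (share H i) = V j (share H j)))"

definition allocation :: "nat \<Rightarrow> (nat \<Rightarrow> real set) \<Rightarrow> bool" where
  "allocation n Q \<longleftrightarrow>
     (\<forall>i<n. piece (Q i)) \<and> (\<forall>i<n. \<forall>j<n. i \<noteq> j \<longrightarrow> finite (Q i \<inter> Q j))"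

definition pareto_optimal :: "tie \<Rightarrow> bool" where
  "pareto_optimal \<tau> \<longleftrightarrow> (\<forall>n k V. setting n k V \<longrightarrow>
     (let H = outcome \<tau> n k V in
      \<not> (\<exists>Q. allocation n Q \<and> (\<exists>i<n. V i (Q i) > V i (share H i) \<and>
             (\<forall>j<n. j \<noteq> i \<longrightarrow> V j (Q j) \<ge> V j (share H j))))))"

definition weakly_pareto_optimal :: "tie \<Rightarrow> bool" where
  "weakly_pareto_optimal \<tau> \<longleftrightarrow> (\<forall>n k V. setting n k V \<longrightarrow>
     (let H = outcome \<tau> n k V in
      \<not> (\<exists>Q. allocation n Q \<and> (\<forall>i<n. V i (Q i) > V i (share H i)))))"

text \<open>The situations a player may face on arrival: whatever the earlier players may have done.\<close>

definition situation :: "tie \<Rightarrow> nat \<Rightarrow> nat \<Rightarrow> nat \<Rightarrow> history \<Rightarrow> bool" where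
  "situation \<tau> n k i h \<longleftrightarrow>
     (\<exists>S. (\<forall>j<n. strategy (S j)) \<and> h = rounds \<tau> n k S (arrival k i))"

definition guarantee ::
  "tie \<Rightarrow> nat \<Rightarrow> nat \<Rightarrow> (real set \<Rightarrow> real) \<Rightarrow> nat \<Rightarrow> history \<Rightarrow> strat \<Rightarrow> real" where
  "guarantee \<tau> n k v i h \<sigma> =
     Inf {v (share (play \<tau> n k S) i) | S.
            (\<forall>j<n. strategy (S j)) \<and> S i = \<sigma> \<and> rounds \<tau> n k S (arrival k i) = h}"

definition weakly_truthful :: "tie \<Rightarrow> bool" where
  "weakly_truthful \<tau> \<longleftrightarrow>
     (\<forall>n k v i h \<sigma>. 2 \<le> k \<and> k < n \<and> i < n \<and> valuation v \<and> situation \<tau> n k i h \<and> strategy \<sigma> \<longrightarrow>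
        guarantee \<tau> n k v i h \<sigma> \<le> guarantee \<tau> n k v i h (truthful_strat n v))"

definition truthful :: "tie \<Rightarrow> bool" where
  "truthful \<tau> \<longleftrightarrow> (\<forall>n k V. setting n k V \<longrightarrow>
     \<not> (\<exists>i<n. \<exists>\<sigma>. strategy \<sigma> \<and>
          V i (share (play \<tau> n k ((truthful_profile n V)(i := \<sigma>))) i)
            > V i (share (outcome \<tau> n k V) i)))"

definition surjective :: "tie \<Rightarrow> bool" where
  "surjective \<tau> \<longleftrightarrow> (\<forall>n k. \<forall>x :: nat \<Rightarrow> real. 2 \<le> k \<and> k < n \<and>
     x 0 = 0 \<and> x n = 1 \<and> (\<forall>m<n. x m < x (Suc m)) \<longrightarrow>
     (\<exists>V \<pi>. (\<forall>i<n. valuation (V i)) \<and> bij_betw \<pi> {..<n} {..<n} \<and>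
        (\<forall>i<n. share (outcome \<tau> n k V) i = {x (\<pi> i)..x (Suc (\<pi> i))})))"

definition scale_invariant :: "tie \<Rightarrow> bool" where
  "scale_invariant \<tau> \<longleftrightarrow> (\<forall>n k V. setting n k V \<longrightarrow>
     (\<forall>i<n. \<forall>c>0. \<forall>j<n.
        share (outcome \<tau> n k (V(i := (\<lambda>P. c * V i P)))) j = share (outcome \<tau> n k V) j))"

definition sequential :: "tie \<Rightarrow> bool" where
  "sequential \<tau> \<longleftrightarrow> (\<forall>n k V. setting n k V \<longrightarrow>
     (let H = outcome \<tau> n k V in
      \<forall>i<n. \<forall>j<n. departure H i < departure H j \<longrightarrow>
        (\<forall>x\<in>share H i. \<forall>y\<in>share H j. x \<le> y)))"

text \<open>The player at position \<open>i\<close> moves to position \<open>j \<le> i\<close>; those in between shift back by one.\<close>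

definition move_earlier :: "nat \<Rightarrow> nat \<Rightarrow> (nat \<Rightarrow> 'a) \<Rightarrow> nat \<Rightarrow> 'a" where
  "move_earlier i j V m = (if m = j then V i else if j < m \<and> m \<le> i then V (m - 1) else V m)"

definition order_monotonic :: "tie \<Rightarrow> bool" where
  "order_monotonic \<tau> \<longleftrightarrow> (\<forall>n k V. setting n k V \<longrightarrow>
     (\<forall>i<n. \<forall>j<i. V i (share (outcome \<tau> n k V) i)
        \<le> V i (share (outcome \<tau> n k (move_earlier i j V)) j)))"

end

theory Submission
  imports Defs
begin

text \<open>
  Fix a valuation and consider, before each round, the value of the remaining cake divided by the
  number of players still to be served. A round in which some player present calls truthfully for
  this valuation cuts off a slice worth at most this mean, so the mean does not decrease; if the
  winner calls truthfully for it, the slice is worth exactly the mean, which is then preserved.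
  The first fact, applied to a truthful player's own valuation, bounds that player's share from
  below by the mean at every earlier round; the second one, applied to opponents who all use the
  player's own valuation, bounds the share from above by the mean on arrival.
  The procedure fails the remaining properties because a player arriving late may find the part
  of the cake they value most already taken, and because a player present from the start may
  leave too early when the players after them do not value the middle of the cake.
\<close>

section \<open>Valuations\<close>

lemma piece_Icc:
  assumes "0 \<le> a" "b \<le> 1"
  shows "piece {a..b}"
  unfolding piece_def
  using assms by (intro exI[of _ "{{a..b}}"]) (simp add: is_interval_cc)

lemma valuation_nonneg:
  assumes "valuation v" "0 \<le> a" "b \<le> 1"
  shows "0 \<le> v {a..b}"
  using assms piece_Icc[of a b] by (simp add: valuation_def)

lemma valuation_split:
  assumes "valuation v" "0 \<le> a" "a \<le> b" "b \<le> c" "c \<le> 1"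
  shows "v {a..c} = v {a..b} + v {b..c}"
proof -
  have "{a..b} \<inter> {b..c} = {b}" "{a..c} = {a..b} \<union> {b..c}"
    using assms by auto
  moreover have "piece {a..b}" "piece {b..c}"
    using assms by (auto intro: piece_Icc)
  ultimately show ?thesis
    using assms(1) unfolding valuation_def by (metis finite.emptyI finite_insert)
qed

lemma valuation_mono:
  assumes "valuation v" "0 \<le> a" "a \<le> b" "b \<le> c" "c \<le> 1"
  shows "v {a..b} \<le> v {a..c}"
  using valuation_split[OF assms] valuation_nonneg[of v b c] assms by linarith

lemma valuation_continuous_right_end:
  assumes "valuation v" "0 \<le> a"
  shows "continuous_on {a..1} (\<lambda>t. v {a..t})"
proof -
  have cont: "continuous_on {(a, b). 0 \<le> a \<and> a \<le> b \<and> b \<le> 1} (\<lambda>(a, b). v {a..b})"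
    using assms by (simp add: valuation_def)
  have "continuous_on {a..1} (\<lambda>t. (\<lambda>(a, b). v {a..b}) (a, t))"
    by (rule continuous_on_compose2[OF cont]) (intro continuous_intros, use assms in auto)
  then show ?thesis
    by simp
qed

section \<open>Valuations built from constant densities\<close>

lemma uniform_Icc:
  fixes s t a b :: real
  shows "measure lebesgue ({s..t} \<inter> {a..b}) = max 0 (min t b - max s a)"
proof -
  have "measure lebesgue {l..u} = max 0 (u - l)" for l u :: real
    by (simp add: measure_completion content_real_if)
  then show ?thesis
    by (simp only: Int_atLeastAtMost)
qed

text \<open>Pieces are measurable as finite unions of bounded convex sets, and finite overlaps are
  negligible, which gives additivity.\<close>

lemma valuation_uniform:
  assumes "0 \<le> a" "a < b" "b \<le> 1" "0 < c"
  shows "valuation (\<lambda>P. c * measure lebesgue (P \<inter> {a..b}))"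
proof -
  have meas: "P \<inter> {a..b} \<in> lmeasurable" if P: "piece P" for P
  proof -
    obtain F where F: "finite F" "\<forall>I\<in>F. is_interval I \<and> I \<subseteq> {0..1}" "P = \<Union>F"
      using P unfolding piece_def by blast
    have "I \<in> lmeasurable" if "I \<in> F" for I
    proof (rule measurable_convex)
      show "convex I"
        using F(2) that is_interval_convex by blast
      show "bounded I"
        using F(2) that bounded_closed_interval bounded_subset by metis
    qed
    then have "P \<in> lmeasurable"
      unfolding F(3) by (intro fmeasurable.finite_Union F(1)) blast
    then show ?thesis
      by (rule fmeasurable.Int) (rule lmeasurable_interval)
  qed
  have "measure lebesgue ((P \<union> Q) \<inter> {a..b})
      = measure lebesgue (P \<inter> {a..b}) + measure lebesgue (Q \<inter> {a..b})"
    if "piece P" "piece Q" "finite (P \<inter> Q)" for P Q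
  proof -
    have "negligible ((P \<inter> {a..b}) \<inter> (Q \<inter> {a..b}))"
      by (rule negligible_finite) (rule finite_subset[OF _ that(3)], auto)
    then have "measure lebesgue ((P \<inter> {a..b}) \<inter> (Q \<inter> {a..b})) = 0"
      by (rule negligible_imp_measure0)
    then show ?thesis
      using measure_Un3[OF meas[OF that(1)] meas[OF that(2)]] by (simp add: Int_Un_distrib2)
  qed
  moreover have "continuous_on {(a, b). 0 \<le> a \<and> a \<le> b \<and> b \<le> 1}
      (\<lambda>(s, t). c * measure lebesgue ({s..t} \<inter> {a..b}))"
    unfolding uniform_Icc case_prod_beta' by (intro continuous_intros)
  ultimately show ?thesis
    unfolding valuation_def using assms by (simp add: ring_distribs)
qed

lemma valuation_add:
  assumes "valuation u" "valuation v"
  shows "valuation (\<lambda>P. u P + v P)"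
proof -
  have "continuous_on {(a, b). 0 \<le> a \<and> a \<le> b \<and> b \<le> 1} (\<lambda>(a, b). u {a..b} + v {a..b})"
    using assms unfolding valuation_def case_prod_beta by (auto intro: continuous_on_add)
  then show ?thesis
    using assms unfolding valuation_def by (auto simp: algebra_simps)
qed

lemma valuation_sum:
  assumes "finite I" "I \<noteq> {}" "\<And>i. i \<in> I \<Longrightarrow> valuation (v i)"
  shows "valuation (\<lambda>P. \<Sum>i\<in>I. v i P)"
  using assms
proof (induction rule: finite_ne_induct)
  case (singleton i)
  then show ?case by simp
next
  case (insert i I)
  then show ?case
    using valuation_add[of "v i" "\<lambda>P. \<Sum>i\<in>I. v i P"] by (simp add: insert)
qed

section \<open>Truthful calls\<close>

lemma truthful_strat_strategy:
  assumes "valuation v"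
  shows "strategy (truthful_strat n v)"
  unfolding strategy_def
proof (intro allI impI)
  fix h assume h: "start h \<in> {0..1}"
  let ?A = "{t \<in> {start h..1}. v {start h..1} / real (n - length h) \<le> v {start h..t}}"
  \<comment> \<open>For \<open>n - length h = 0\<close> the quotient is 0 by convention, so 1
    belongs to \<open>?A\<close> in that case as well.\<close>
  have "v {start h..1} / real (n - length h) \<le> v {start h..1}"
    using valuation_nonneg[OF assms, of "start h" 1] h
    by (cases "n - length h") (auto simp: field_simps)
  then have "1 \<in> ?A"
    using h by auto
  moreover have "bdd_below ?A"
    by (rule bdd_belowI[of _ "start h"]) simp
  ultimately show "truthful_strat n v h \<in> {start h..1}"
    unfolding truthful_strat_def atLeastAtMost_iff
    by (intro conjI cInf_greatest cInf_lower) auto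
qed

text \<open>By continuity the threshold is attained exactly: a point of exact value bounds the
  infimum from above, and closedness of the set puts the infimum into it.\<close>

lemma truthful_strat_value:
  assumes v: "valuation v" and h: "start h \<in> {0..1}" "length h < n"
  shows "v {start h..truthful_strat n v h} = v {start h..1} / real (n - length h)"
proof (rule antisym)
  let ?f = "\<lambda>t. v {start h..t}" and ?y = "v {start h..1} / real (n - length h)"
  let ?A = "{t \<in> {start h..1}. ?y \<le> ?f t}"
  have cont: "continuous_on {start h..1} ?f"
    using valuation_continuous_right_end v h by simp
  have "?f (start h) = 0"
    using valuation_split[of v "start h" "start h" "start h"] v h by simp
  moreover have y: "0 \<le> ?y" "?y \<le> ?f 1"
    using valuation_nonneg[OF v, of "start h" 1] h
    by (auto simp: divide_le_eq mult_le_cancel_left1 simp flip: of_nat_diff)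
  ultimately obtain t where t: "start h \<le> t" "t \<le> 1" "?f t = ?y"
    using IVT'[of ?f "start h" ?y 1] cont h by auto
  have bdd: "bdd_below ?A"
    by (rule bdd_below_mono[of "{start h..1}"]) auto
  have le: "truthful_strat n v h \<le> t"
    unfolding truthful_strat_def using t bdd by (intro cInf_lower) auto
  have "start h \<le> truthful_strat n v h"
    using truthful_strat_strategy[OF v, of n] h unfolding strategy_def by auto
  then have "?f (truthful_strat n v h) \<le> ?f t"
    using valuation_mono[OF v _ _ le] t(1,2) h by simp
  also note t(3)
  finally show "?f (truthful_strat n v h) \<le> ?y" .
  have "closed ?A"
    using continuous_on_closed_Collect_le[of "{start h..1}" "\<lambda>_. ?y" ?f] cont by auto
  moreover have "?A \<noteq> {}"
    using t by auto
  ultimately have "truthful_strat n v h \<in> ?A"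
    unfolding truthful_strat_def using bdd by (intro closed_contains_Inf) auto
  then show "?y \<le> ?f (truthful_strat n v h)" by simp
qed

text \<open>For computing calls with explicit densities. Where the density vanishes the value is
  constant, so the call is singled out as the first point reaching the threshold.\<close>

lemma truthful_strat_eqI:
  assumes "t \<in> {start h..1}" "v {start h..t} = v {start h..1} / real (n - length h)"
    "\<And>s. s \<in> {start h..<t} \<Longrightarrow> v {start h..s} < v {start h..1} / real (n - length h)"
  shows "truthful_strat n v h = t"
  unfolding truthful_strat_def
  by (rule cInf_eq_minimum) (use assms in \<open>auto simp: not_less[symmetric]\<close>)

section \<open>The course of play\<close>

lemma length_rounds [simp]: "length (rounds \<tau> n k S m) = m"
  by (induction m) auto

lemma take_rounds:
  assumes "m \<le> m'"
  shows "take m (rounds \<tau> n k S m') = rounds \<tau> n k S m"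
  using assms by (induction m') (auto simp: le_Suc_eq)

lemma nth_rounds:
  assumes "m < m'"
  shows "rounds \<tau> n k S m' ! m = next_round \<tau> n k S (rounds \<tau> n k S m)"
  using assms by (induction m') (auto simp: nth_append less_Suc_eq)

lemma start_append [simp]: "start (h @ [r]) = cut_pos r"
  by (simp add: start_def)

lemma next_round_cong:
  assumes "\<And>i. i \<in> present n k h \<Longrightarrow> S i h = S' i h"
  shows "next_round \<tau> n k S h = next_round \<tau> n k S' h"
proof -
  have "(\<lambda>i. S i h) ` present n k h = (\<lambda>i. S' i h) ` present n k h"
    using assms by (rule image_cong[OF refl])
  moreover have "{i \<in> present n k h. S i h = c} = {i \<in> present n k h. S' i h = c}" for c
    using assms by auto
  ultimately show ?thesis
    by (simp add: next_round_def Let_def)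
qed

text \<open>Only the choices of players present, at the histories actually reached, influence the
  play; so a strategy may be exchanged before its player arrives.\<close>

lemma rounds_cong:
  assumes "\<And>m i. m < d \<Longrightarrow> i \<in> present n k (rounds \<tau> n k S m) \<Longrightarrow>
    S i (rounds \<tau> n k S m) = S' i (rounds \<tau> n k S m)"
  shows "rounds \<tau> n k S' d = rounds \<tau> n k S d"
  using assms
proof (induction d)
  case (Suc d)
  then have "rounds \<tau> n k S' d = rounds \<tau> n k S d" by simp
  then show ?case
    using next_round_cong[of n k "rounds \<tau> n k S d" S S' \<tau>] Suc.prems by simp
qed simp

text \<open>The tie rule returns one of the earliest callers, so the cut is the winner's own call
  and a lower bound for all calls.\<close>

lemma
  assumes "tie_rule \<tau>" "present n k h \<noteq> {}"
  shows taker_next_round: "taker (next_round \<tau> n k S h) \<in> present n k h"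
    and cut_next_round: "\<not> is_singleton (present n k h) \<Longrightarrow>
      cut_pos (next_round \<tau> n k S h) = S (taker (next_round \<tau> n k S h)) h"
    and cut_next_round_le: "\<not> is_singleton (present n k h) \<Longrightarrow> i \<in> present n k h \<Longrightarrow>
      cut_pos (next_round \<tau> n k S h) \<le> S i h"
proof -
  let ?P = "present n k h"
  define c where "c = Min ((\<lambda>i. S i h) ` ?P)"
  let ?C = "{i \<in> ?P. S i h = c}"
  have fin: "finite ?P"
    by (simp add: present_def)
  have "c \<in> (\<lambda>i. S i h) ` ?P"
    unfolding c_def using fin assms(2) by (intro Min_in) auto
  then have "?C \<noteq> {}" by auto
  then have C: "\<tau> ?P ?C \<in> ?C"
    using assms(1)[unfolded tie_rule_def, rule_format, of ?P ?C] fin by simp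
  then show "taker (next_round \<tau> n k S h) \<in> ?P"
    by (cases "is_singleton ?P") (auto simp: next_round_def Let_def c_def is_singleton_the_elem)
  show "\<not> is_singleton ?P \<Longrightarrow>
      cut_pos (next_round \<tau> n k S h) = S (taker (next_round \<tau> n k S h)) h"
    using C by (simp add: next_round_def Let_def c_def)
  show "\<not> is_singleton ?P \<Longrightarrow> i \<in> ?P \<Longrightarrow> cut_pos (next_round \<tau> n k S h) \<le> S i h"
    using fin by (simp add: next_round_def Let_def)
qed

lemma cut_next_round_singleton:
  assumes "is_singleton (present n k h)"
  shows "cut_pos (next_round \<tau> n k S h) = 1"
  using assms by (simp add: next_round_def Let_def)

declare rounds.simps(2) [simp del]

section \<open>Plays under arbitrary strategies: departures and knife positions\<close>

locale moving_knife =
  fixes \<tau> :: tie and n k :: nat and S :: "nat \<Rightarrow> strat"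
  assumes tie: "tie_rule \<tau>" and k: "2 \<le> k" "k < n"
    and S: "\<And>i. i < n \<Longrightarrow> strategy (S i)"
begin

abbreviation hist :: "nat \<Rightarrow> history" where
  "hist m \<equiv> rounds \<tau> n k S m"

abbreviation knife :: "nat \<Rightarrow> real" where
  "knife m \<equiv> start (hist m)"

abbreviation winner :: "nat \<Rightarrow> nat" where
  "winner m \<equiv> taker (next_round \<tau> n k S (hist m))"

abbreviation dep :: "nat \<Rightarrow> nat" where
  "dep i \<equiv> departure (hist n) i"

lemma takers_hist: "map taker (hist m) = map winner [0..<m]"
  by (induction m) (auto simp: rounds.simps(2))

lemma takers_hist_set: "taker ` set (hist m) = winner ` {..<m}"
  using arg_cong[OF takers_hist[of m], of set] by (simp add: lessThan_atLeast0)

text \<open>The two claims need a joint induction: distinct earlier winners mean exactly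
  \<open>m\<close> departures among \<open>min n (k + m) > m\<close> arrivals, so somebody is
  present to win round \<open>m\<close>, and this winner is new.\<close>

lemma winner_inj_and_bound:
  assumes "m \<le> n"
  shows "inj_on winner {..<m} \<and> winner ` {..<m} \<subseteq> {..<min n (k + m)}"
  using assms
proof (induction m)
  case (Suc m)
  then have IH: "inj_on winner {..<m}" "winner ` {..<m} \<subseteq> {..<min n (k + m)}"
    by auto
  have "card (winner ` {..<m}) < card {..<min n (k + m)}"
    using IH(1) Suc.prems k by (simp add: card_image)
  then have "present n k (hist m) \<noteq> {}"
    unfolding present_def length_rounds takers_hist_set
    by (metis Diff_eq_empty_iff card_mono finite_imageI finite_lessThan not_less)
  then have "winner m \<in> present n k (hist m)"
    by (rule taker_next_round[OF tie])
  then have "winner m \<notin> winner ` {..<m}" "winner m < min n (k + m)"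
    unfolding present_def length_rounds takers_hist_set by auto
  with IH show ?case
    by (auto simp: lessThan_Suc)
qed simp

lemma card_present:
  assumes "m \<le> n"
  shows "card (present n k (hist m)) = min (n - m) k"
proof -
  have "card (present n k (hist m)) = card {..<min n (k + m)} - card (winner ` {..<m})"
    using winner_inj_and_bound[OF assms]
    unfolding present_def length_rounds takers_hist_set by (intro card_Diff_subset) auto
  also have "\<dots> = min n (k + m) - m"
    using winner_inj_and_bound[OF assms] by (simp add: card_image)
  also have "\<dots> = min (n - m) k"
    by simp
  finally show ?thesis .
qed

lemma present_nonempty:
  assumes "m < n"
  shows "present n k (hist m) \<noteq> {}"
  using card_present[of m] assms k by auto

text \<open>Since \<open>k \<ge> 2\<close>, the number \<open>min (n - m) k\<close> of players
  present drops to 1 only in the last round.\<close>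

lemma is_singleton_present_iff:
  assumes "m < n"
  shows "is_singleton (present n k (hist m)) \<longleftrightarrow> Suc m = n"
  unfolding is_singleton_altdef using card_present[of m] assms k by auto

lemma winner_present:
  assumes "m < n"
  shows "winner m \<in> present n k (hist m)"
  using taker_next_round[OF tie present_nonempty[OF assms]] .

lemma knife_last: "knife n = 1"
proof -
  obtain m where m: "n = Suc m"
    using k by (cases n) auto
  then have "is_singleton (present n k (hist m))"
    using is_singleton_present_iff by simp
  then show ?thesis
    using cut_next_round_singleton m by (simp add: rounds.simps(2))
qed

lemma knife_Suc:
  assumes "Suc m < n"
  shows "knife (Suc m) = S (winner m) (hist m)"
    and "i \<in> present n k (hist m) \<Longrightarrow> knife (Suc m) \<le> S i (hist m)"
  using cut_next_round[OF tie present_nonempty] cut_next_round_le[OF tie present_nonempty]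
    is_singleton_present_iff[of m] assms by (simp_all add: rounds.simps(2))

text \<open>The range has to be carried through the induction because \<open>strategy\<close>
  constrains a call only when the knife starts in \<open>{0..1}\<close>.\<close>

lemma knife_range:
  assumes "m \<le> n"
  shows "knife m \<in> {0..1}"
  using assms
proof (induction m)
  case (Suc m)
  show ?case
  proof (cases "Suc m = n")
    case False
    have "winner m < n"
      using winner_present[of m] Suc.prems by (simp add: present_def)
    then have "S (winner m) (hist m) \<in> {knife m..1}"
      using S Suc unfolding strategy_def by simp
    then show ?thesis
      using knife_Suc[of m] Suc False by simp
  qed (use knife_last in simp)
qed (simp add: start_def)

lemma knife_mono_Suc:
  assumes "m < n"
  shows "knife m \<le> knife (Suc m)"
proof (cases "Suc m = n")
  case True
  then show ?thesis
    using knife_last knife_range[of m] by simp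
next
  case False
  have "winner m < n"
    using winner_present[of m] assms by (simp add: present_def)
  then have "S (winner m) (hist m) \<in> {knife m..1}"
    using S knife_range[of m] assms unfolding strategy_def by simp
  then show ?thesis
    using knife_Suc[of m] assms False by simp
qed

lemma knife_mono:
  assumes "m \<le> m'" "m' \<le> n"
  shows "knife m \<le> knife m'"
  using assms
proof (induction m' rule: dec_induct)
  case (step m')
  then show ?case
    using knife_mono_Suc[of m'] by simp
qed simp

lemma winner_bij: "bij_betw winner {..<n} {..<n}"
proof -
  have "winner ` {..<n} = {..<n}"
    using winner_inj_and_bound[of n] by (intro card_subset_eq) (auto simp: card_image)
  then show ?thesis
    using winner_inj_and_bound[of n] by (simp add: bij_betw_def)
qed

lemma dep_winner:
  assumes "m < n"
  shows "dep (winner m) = m"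
  unfolding departure_def
  using assms winner_bij by (intro the_equality) (auto simp: nth_rounds bij_betw_def inj_on_def)

lemma
  assumes "i < n"
  shows dep_less: "dep i < n" and winner_dep: "winner (dep i) = i"
proof -
  have "i \<in> winner ` {..<n}"
    using winner_bij assms by (auto simp: bij_betw_def)
  then obtain m where "m < n" "i = winner m" by auto
  then show "dep i < n" "winner (dep i) = i"
    by (simp_all add: dep_winner)
qed

lemma share_eq:
  assumes "i < n"
  shows "share (hist n) i = {knife (dep i)..knife (Suc (dep i))}"
  using dep_less[OF assms] winner_dep[OF assms]
  by (simp add: share_def slice_def nth_rounds take_rounds rounds.simps(2))

text \<open>\<open>arrival k i \<le> m\<close> is \<open>i < k + m\<close> written with truncated
  subtraction; the other bound holds because every player wins exactly one round.\<close>

lemma present_iff: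
  assumes "i < n" "m \<le> n"
  shows "i \<in> present n k (hist m) \<longleftrightarrow> arrival k i \<le> m \<and> m \<le> dep i"
proof -
  have "i \<in> winner ` {..<m} \<longleftrightarrow> dep i < m"
  proof
    assume "i \<in> winner ` {..<m}"
    then show "dep i < m"
      using assms dep_winner by auto
  next
    assume "dep i < m"
    then show "i \<in> winner ` {..<m}"
      using winner_dep[OF assms(1)] by (metis imageI lessThan_iff)
  qed
  then show ?thesis
    unfolding present_def length_rounds takers_hist_set arrival_def using assms by auto
qed

lemma arrival_le_dep:
  assumes "i < n"
  shows "arrival k i \<le> dep i"
  using winner_present[OF dep_less[OF assms]] present_iff[OF assms, of "dep i"]
    dep_less[OF assms] winner_dep[OF assms] by simp

section \<open>The mean value of the remaining cake per player still to be served\<close>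

abbreviation mean :: "(real set \<Rightarrow> real) \<Rightarrow> nat \<Rightarrow> real" where
  "mean v m \<equiv> v {knife m..1} / real (n - m)"

lemma slice_eq_mean:
  assumes v: "valuation v" and m: "m < n"
    and "Suc m < n \<Longrightarrow> S (winner m) (hist m) = truthful_strat n v (hist m)"
  shows "v {knife m..knife (Suc m)} = mean v m"
proof (cases "Suc m = n")
  \<comment> \<open>No call decides the last round: the divisor is 1 and the slice is all that
    remains.\<close>
  case True
  then have "n - m = 1" by simp
  then show ?thesis
    using True knife_last by simp
next
  case False
  then have "knife (Suc m) = truthful_strat n v (hist m)"
    using assms knife_Suc(1)[of m] by simp
  then show ?thesis
    using truthful_strat_value[OF v, of "hist m" n] knife_range[of m] m by simp
qed

text \<open>The knife never passes the call of a player present, so the slice lies inside the one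
  that the truthful caller was waiting for.\<close>

lemma slice_le_mean:
  assumes v: "valuation v" and m: "m < n"
    and i: "Suc m < n \<Longrightarrow>
      \<exists>i\<in>present n k (hist m). S i (hist m) = truthful_strat n v (hist m)"
  shows "v {knife m..knife (Suc m)} \<le> mean v m"
proof (cases "Suc m = n")
  case True
  then show ?thesis
    using slice_eq_mean[OF v m] by simp
next
  case False
  have "knife (Suc m) \<le> truthful_strat n v (hist m)"
    using i knife_Suc(2)[of m] m False by fastforce
  moreover have "truthful_strat n v (hist m) \<in> {knife m..1}"
    using truthful_strat_strategy[OF v, of n] knife_range[of m] m by (simp add: strategy_def)
  ultimately have "v {knife m..knife (Suc m)} \<le> v {knife m..truthful_strat n v (hist m)}"
    using knife_range[of m] knife_mono_Suc[OF m] m by (intro valuation_mono[OF v]) auto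
  then show ?thesis
    using truthful_strat_value[OF v, of "hist m" n] knife_range[of m] m by simp
qed

text \<open>Removing exactly the average leaves the average of the rest unchanged, and removing less
  can only raise it. \<open>Suc m < n\<close> keeps the new divisor positive.\<close>

lemma mean_Suc:
  assumes v: "valuation v" and m: "Suc m < n"
  shows "v {knife m..knife (Suc m)} = mean v m \<Longrightarrow> mean v (Suc m) = mean v m"
    and "v {knife m..knife (Suc m)} \<le> mean v m \<Longrightarrow> mean v m \<le> mean v (Suc m)"
proof -
  have split: "v {knife m..1} = v {knife m..knife (Suc m)} + v {knife (Suc m)..1}"
    using knife_range[of m] knife_range[of "Suc m"] knife_mono_Suc[of m] m
    by (intro valuation_split[OF v]) auto
  obtain r where r: "real (n - m) = r + 1" "real (n - Suc m) = r" "0 < r"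
    using m by (metis Suc_diff_Suc Suc_lessD of_nat_0_less_iff of_nat_Suc zero_less_diff add.commute)
  show "v {knife m..knife (Suc m)} = mean v m \<Longrightarrow> mean v (Suc m) = mean v m"
    using split r by (simp add: field_simps)
  show "v {knife m..knife (Suc m)} \<le> mean v m \<Longrightarrow> mean v m \<le> mean v (Suc m)"
    using split r by (simp add: field_simps)
qed

lemma mean_mono:
  assumes v: "valuation v"
    and "\<And>m. d \<le> m \<Longrightarrow> m < e \<Longrightarrow> v {knife m..knife (Suc m)} \<le> mean v m"
    and "d \<le> e" "e < n"
  shows "mean v d \<le> mean v e"
  using assms(3,2,4)
proof (induction e rule: dec_induct)
  case (step m)
  then show ?case
    using mean_Suc(2)[OF v, of m] by force
qed simp

lemma mean_const:
  assumes v: "valuation v"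
    and "\<And>m. d \<le> m \<Longrightarrow> m < e \<Longrightarrow> v {knife m..knife (Suc m)} = mean v m"
    and "d \<le> e" "e < n"
  shows "mean v e = mean v d"
  using assms(3,2,4)
proof (induction e rule: dec_induct)
  case (step m)
  then show ?case
    using mean_Suc(1)[OF v, of m] by force
qed simp

text \<open>The mean cannot fall while the player is present, and the slice taken at departure is
  worth exactly the mean. The first bound serves proportionality and guarantees, the second one
  envy.\<close>

lemma truthful_player:
  assumes v: "valuation v" and i: "i < n"
    and S_i: "\<And>m. arrival k i \<le> m \<Longrightarrow> m < n \<Longrightarrow> S i (hist m) = truthful_strat n v (hist m)"
    and m: "arrival k i \<le> m" "m \<le> dep i"
  shows "mean v m \<le> v (share (hist n) i)"
    and "v {knife m..knife (Suc m)} \<le> v (share (hist n) i)"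
proof -
  have le: "v {knife m'..knife (Suc m')} \<le> mean v m'" if "m \<le> m'" "m' \<le> dep i" for m'
    using that m dep_less[OF i] present_iff[OF i, of m'] S_i[of m']
    by (intro slice_le_mean[OF v]) auto
  have "mean v m \<le> mean v (dep i)"
    using le m dep_less[OF i] by (intro mean_mono[OF v]) auto
  also have "mean v (dep i) = v (share (hist n) i)"
    using slice_eq_mean[OF v dep_less[OF i]] S_i[of "dep i"] arrival_le_dep[OF i]
      dep_less[OF i] winner_dep[OF i] share_eq[OF i] by simp
  finally show "mean v m \<le> v (share (hist n) i)" .
  with le[of m] m show "v {knife m..knife (Suc m)} \<le> v (share (hist n) i)"
    by simp
qed

lemma present_other:
  assumes "Suc m < n"
  obtains j where "j \<in> present n k (hist m)" "j \<noteq> i"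
proof -
  have "card (present n k (hist m)) \<ge> 2"
    using card_present[of m] assms k by simp
  then have "\<not> present n k (hist m) \<subseteq> {i}"
    using card_mono[of "{i}" "present n k (hist m)"] by auto
  then show ?thesis
    using that by blast
qed

text \<open>Until \<open>i\<close> departs, all winners call by \<open>v\<close>, which keeps the
  mean constant. If \<open>i\<close> wins before the last round, an opponent still present caps the
  slice; in the last round the slice equals the mean.\<close>

lemma truthful_opponents:
  assumes v: "valuation v" and i: "i < n"
    and opp: "\<And>j m. j \<noteq> i \<Longrightarrow> j < n \<Longrightarrow> arrival k i \<le> m \<Longrightarrow> m < n \<Longrightarrow>
      S j (hist m) = truthful_strat n v (hist m)"
  shows "v (share (hist n) i) \<le> mean v (arrival k i)"
proof -
  have "v {knife m..knife (Suc m)} = mean v m" if "arrival k i \<le> m" "m < dep i" for m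
  proof (rule slice_eq_mean[OF v])
    show "m < n"
      using that dep_less[OF i] by simp
    moreover from this have "winner m \<noteq> i" "winner m < n"
      using that dep_winner[of m] winner_present[of m] by (auto simp: present_def)
    ultimately show "S (winner m) (hist m) = truthful_strat n v (hist m)"
      using opp that by simp
  qed
  then have "mean v (dep i) = mean v (arrival k i)"
    using arrival_le_dep[OF i] dep_less[OF i] by (intro mean_const[OF v])
  moreover have "v {knife (dep i)..knife (Suc (dep i))} \<le> mean v (dep i)"
  proof (rule slice_le_mean[OF v dep_less[OF i]])
    assume "Suc (dep i) < n"
    then obtain j where j: "j \<in> present n k (hist (dep i))" "j \<noteq> i"
      by (rule present_other)
    then have "j < n"
      by (simp add: present_def)
    then have "S j (hist (dep i)) = truthful_strat n v (hist (dep i))"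
      using opp j arrival_le_dep[OF i] dep_less[OF i] by simp
    then show "\<exists>j\<in>present n k (hist (dep i)).
        S j (hist (dep i)) = truthful_strat n v (hist (dep i))"
      using j by blast
  qed
  ultimately show ?thesis
    using share_eq[OF i] by simp
qed

text \<open>Provides the lower bound that makes the infimum in \<open>guarantee\<close>
  meaningful.\<close>

lemma share_nonneg:
  assumes "valuation v" "i < n"
  shows "0 \<le> v (share (hist n) i)"
  unfolding share_eq[OF assms(2)]
  using knife_range[of "dep i"] knife_range[of "Suc (dep i)"] dep_less[OF assms(2)]
  by (intro valuation_nonneg[OF assms(1)]) auto

end

section \<open>Properties that hold\<close>

lemma moving_knife_truthful_profile:
  assumes "tie_rule \<tau>" "setting n k V"
  shows "moving_knife \<tau> n k (truthful_profile n V)"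
  using assms truthful_strat_strategy
  by unfold_locales (auto simp: setting_def truthful_profile_def[abs_def])

text \<open>After cancelling \<open>V i {0..1}\<close>, the required amount is the mean on arrival,
  and \<open>truthful_player(1)\<close> applies.\<close>

lemma forward_proportional_moving_knife:
  assumes "tie_rule \<tau>"
  shows "forward_proportional \<tau>"
  unfolding forward_proportional_def Let_def
proof (intro allI impI)
  fix n k i :: nat and V :: "nat \<Rightarrow> real set \<Rightarrow> real"
  assume set: "setting n k V" and i: "i < n"
  interpret moving_knife \<tau> n k "truthful_profile n V"
    by (rule moving_knife_truthful_profile) fact+
  have V: "valuation (V i)"
    using set i by (simp add: setting_def)
  have "mean (V i) (arrival k i) \<le> V i (share (hist n) i)"
    using arrival_le_dep[OF i]
    by (intro truthful_player(1)[OF V i]) (auto simp: truthful_profile_def)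
  moreover have "V i {0..1} \<noteq> 0"
    using V by (simp add: valuation_def)
  ultimately show "V i {start (take (arrival k i) (outcome \<tau> n k V))..1} / V i {0..1}
      / real (n - arrival k i) * V i {0..1} \<le> V i (share (outcome \<tau> n k V) i)"
    using arrival_le_dep[OF i] dep_less[OF i] by (simp add: outcome_def take_rounds)
qed

text \<open>This is \<open>truthful_player(2)\<close> at the round in which \<open>j\<close>
  departs.\<close>

lemma immediately_envy_free_moving_knife:
  assumes "tie_rule \<tau>"
  shows "immediately_envy_free \<tau>"
  unfolding immediately_envy_free_def Let_def
proof (intro allI impI)
  fix n k i j :: nat and V :: "nat \<Rightarrow> real set \<Rightarrow> real"
  assume set: "setting n k V" and i: "i < n" and j: "j < n"
    and "arrival k i \<le> departure (outcome \<tau> n k V) j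
      \<and> departure (outcome \<tau> n k V) j < departure (outcome \<tau> n k V) i"
  then have dep: "arrival k i \<le> departure (play \<tau> n k (truthful_profile n V)) j"
    "departure (play \<tau> n k (truthful_profile n V)) j
      \<le> departure (play \<tau> n k (truthful_profile n V)) i"
    by (simp_all add: outcome_def)
  interpret moving_knife \<tau> n k "truthful_profile n V"
    by (rule moving_knife_truthful_profile) fact+
  have "valuation (V i)"
    using set i by (simp add: setting_def)
  from truthful_player(2)[OF this i _ dep]
  show "V i (share (outcome \<tau> n k V) j) \<le> V i (share (outcome \<tau> n k V) i)"
    by (simp add: outcome_def truthful_profile_def share_eq[OF j])
qed

lemma sequential_moving_knife:
  assumes "tie_rule \<tau>"
  shows "sequential \<tau>"
  unfolding sequential_def Let_def
proof (intro allI impI ballI)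
  fix n k i j :: nat and V :: "nat \<Rightarrow> real set \<Rightarrow> real" and x y
  assume set: "setting n k V" and i: "i < n" and j: "j < n"
    and dep: "departure (outcome \<tau> n k V) i < departure (outcome \<tau> n k V) j"
    and x: "x \<in> share (outcome \<tau> n k V) i" and y: "y \<in> share (outcome \<tau> n k V) j"
  interpret moving_knife \<tau> n k "truthful_profile n V"
    by (rule moving_knife_truthful_profile) fact+
  have "knife (Suc (dep i)) \<le> knife (dep j)"
    using dep dep_less[OF j] by (intro knife_mono) (auto simp: outcome_def)
  then show "x \<le> y"
    using x y by (simp add: outcome_def share_eq[OF i] share_eq[OF j])
qed

text \<open>A positive factor cancels in the inequality defining a call, so the strategies
  themselves are unchanged.\<close>

lemma scale_invariant_moving_knife: "scale_invariant \<tau>"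
proof -
  have "truthful_strat n (\<lambda>P. c * v P) = truthful_strat n v" if "c > 0" for n c v
    using that
    by (intro ext) (simp add: truthful_strat_def mult_le_cancel_left_pos
        flip: times_divide_eq_right)
  then have "truthful_profile n (V(i := (\<lambda>P. c * V i P))) = truthful_profile n V"
    if "c > 0" for n c i and V :: "nat \<Rightarrow> real set \<Rightarrow> real"
    using that by (intro ext) (simp add: truthful_profile_def)
  then show ?thesis
    by (simp add: scale_invariant_def outcome_def)
qed

text \<open>
  No strategy guarantees more than the mean on arrival, because all opponents may happen to use
  the truthful strategy of the player's own valuation.
\<close>

lemma weakly_truthful_moving_knife:
  assumes tie: "tie_rule \<tau>"
  shows "weakly_truthful \<tau>"
  unfolding weakly_truthful_def
proof (intro allI impI)
  fix n k i :: nat and v :: "real set \<Rightarrow> real" and h \<sigma>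
  assume "2 \<le> k \<and> k < n \<and> i < n \<and> valuation v \<and> situation \<tau> n k i h \<and> strategy \<sigma>"
  then have k: "2 \<le> k" "k < n" and i: "i < n" and v: "valuation v"
    and sit: "situation \<tau> n k i h" and \<sigma>: "strategy \<sigma>"
    by auto
  let ?d = "arrival k i" and ?t = "truthful_strat n v"
  let ?X = "\<lambda>\<sigma>. {v (share (play \<tau> n k S) i) | S.
    (\<forall>j<n. strategy (S j)) \<and> S i = \<sigma> \<and> rounds \<tau> n k S ?d = h}"
  obtain S0 where S0: "\<And>j. j < n \<Longrightarrow> strategy (S0 j)" "h = rounds \<tau> n k S0 ?d"
    using sit unfolding situation_def by blast
  \<comment> \<open>The opponents reproduce the given situation through \<open>S0\<close> until
    \<open>i\<close> arrives and then call by \<open>v\<close>; player \<open>i\<close> follows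
    \<open>\<rho>\<close> throughout.\<close>
  define S where "S \<rho> j g = (if j = i then \<rho> g else if length g < ?d then S0 j g else ?t g)"
    for \<rho> :: strat and j g
  have strat: "strategy (S \<rho> j)" if "strategy \<rho>" "j < n" for \<rho> j
    using that S0(1)[of j] truthful_strat_strategy[OF v, of n] by (auto simp: strategy_def S_def)
  \<comment> \<open>Before round \<open>?d\<close> player \<open>i\<close> is not present, so
    \<open>\<rho>\<close> cannot affect the history.\<close>
  have hist: "rounds \<tau> n k (S \<rho>) ?d = h" for \<rho>
    unfolding S0(2) by (rule rounds_cong) (auto simp: S_def present_def arrival_def)
  have S_i: "S \<rho> i = \<rho>" for \<rho>
    by (simp add: S_def fun_eq_iff)
  have elem: "v (share (play \<tau> n k (S \<rho>)) i) \<in> ?X \<rho>" if "strategy \<rho>" for \<rho>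
    using strat[OF that] hist[of \<rho>] S_i[of \<rho>] by blast
  have lower: "v {start h..1} / real (n - ?d) \<le> x" if x: "x \<in> ?X ?t" for x
  proof -
    obtain T where T: "\<And>j. j < n \<Longrightarrow> strategy (T j)" "T i = ?t" "rounds \<tau> n k T ?d = h"
      "x = v (share (play \<tau> n k T) i)"
      using x by blast
    interpret moving_knife \<tau> n k T
      by unfold_locales (use tie k T in auto)
    show ?thesis
      using truthful_player(1)[OF v i _ order_refl arrival_le_dep[OF i]] T by simp
  qed
  have upper: "v (share (play \<tau> n k (S \<sigma>)) i) \<le> v {start h..1} / real (n - ?d)"
  proof -
    interpret moving_knife \<tau> n k "S \<sigma>"
      by unfold_locales (use tie k strat \<sigma> in auto)
    show ?thesis
      using truthful_opponents[OF v i] by (simp add: hist S_def)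
  qed
  have "bdd_below (?X \<sigma>)"
  proof (rule bdd_belowI)
    fix x assume "x \<in> ?X \<sigma>"
    then obtain T where T: "\<And>j. j < n \<Longrightarrow> strategy (T j)" "x = v (share (play \<tau> n k T) i)"
      by blast
    interpret moving_knife \<tau> n k T
      by unfold_locales (use tie k T in auto)
    show "0 \<le> x"
      using share_nonneg[OF v i] T by simp
  qed
  then have "Inf (?X \<sigma>) \<le> v {start h..1} / real (n - ?d)"
    by (rule cInf_lower2[OF elem[OF \<sigma>] upper])
  also have "\<dots> \<le> Inf (?X ?t)"
  proof (rule cInf_greatest)
    show "?X ?t \<noteq> {}"
      using elem[OF truthful_strat_strategy[OF v]] by blast
  qed (rule lower)
  finally show "guarantee \<tau> n k v i h \<sigma> \<le> guarantee \<tau> n k v i h ?t"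
    unfolding guarantee_def .
qed

text \<open>
  All players share a valuation with positive density giving each prescribed slice the value 1;
  every round then cuts off a slice of value 1.
\<close>

lemma surjective_moving_knife:
  assumes tie: "tie_rule \<tau>"
  shows "surjective \<tau>"
  unfolding surjective_def
proof (intro allI impI)
  fix n k :: nat and x :: "nat \<Rightarrow> real"
  assume "2 \<le> k \<and> k < n \<and> x 0 = 0 \<and> x n = 1 \<and> (\<forall>m<n. x m < x (Suc m))"
  then have k: "2 \<le> k" "k < n" and x: "x 0 = 0" "x n = 1" "\<And>m. m < n \<Longrightarrow> x m < x (Suc m)"
    by auto
  have x_less: "x l < x m" if "l < m" "m \<le> n" for l m
    using that
  proof (induction m)
    case (Suc m)
    then show ?case
      using x(3)[of m] by (cases "l = m") auto
  qed simp
  have x_le: "x l \<le> x m" if "l \<le> m" "m \<le> n" for l m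
    using x_less[of l m] that by (cases "l = m") auto
  \<comment> \<open>Uniform density of total mass 1 on slice \<open>m\<close>.\<close>
  define u where "u m P = 1 / (x (Suc m) - x m) * measure lebesgue (P \<inter> {x m..x (Suc m)})"
    for m P
  define v where "v P = (\<Sum>m<n. u m P)" for P
  have u_Icc: "u m {s..t} = max 0 (min t (x (Suc m)) - max s (x m)) / (x (Suc m) - x m)" for m s t
    unfolding u_def uniform_Icc by simp
  have u: "valuation (u m)" if "m < n" for m
    unfolding u_def[abs_def] using x_le[of 0 m] x_le[of "Suc m" n] x(1,2) x(3)[of m] that
    by (intro valuation_uniform) auto
  then have v: "valuation v"
    unfolding v_def[abs_def] using k u by (intro valuation_sum) auto
  have v_unit: "v {x m..x (Suc m)} = 1" if m: "m < n" for m
  proof -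
    have "u l {x m..x (Suc m)} = (if l = m then 1 else 0)" if "l < n" for l
    proof -
      consider "l = m" | "Suc l \<le> m" | "Suc m \<le> l"
        by linarith
      then show ?thesis
        using x_le[of "Suc l" m] x_le[of "Suc m" l] x(3)[of m] m that
        by cases (auto simp: u_Icc)
    qed
    then have "v {x m..x (Suc m)} = (\<Sum>l<n. if l = m then 1 else 0)"
      unfolding v_def by (intro sum.cong) auto
    then show ?thesis
      using m by simp
  qed
  have x_range: "x m \<in> {0..1}" if "m \<le> n" for m
    using x_le[of 0 m] x_le[of m n] x that by simp
  have v_x: "v {x m..1} = real (n - m)" if "m \<le> n" for m
    using that
  proof (induction m rule: inc_induct)
    case base
    then show ?case
      using valuation_split[OF v, of 1 1 1] x by simp
  next
    case (step m)
    then show ?case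
      using valuation_split[OF v, of "x m" "x (Suc m)" 1] x_range[of m] x_range[of "Suc m"]
        x(3)[of m] v_unit[of m] by simp
  qed
  \<comment> \<open>Positivity makes the remaining value strictly decreasing in the knife position,
    so this value determines the position.\<close>
  have v_pos: "0 < v {s..t}" if st: "0 \<le> s" "s < t" "t \<le> 1" for s t
  proof -
    \<comment> \<open>The least such \<open>m\<close> yields the slice \<open>l\<close> with
      \<open>x l \<le> s < x (Suc l)\<close>, whose density alone makes \<open>{s..t}\<close>
      valuable.\<close>
    obtain m where m: "m \<le> n" "s < x m" "\<And>l. l < m \<Longrightarrow> \<not> s < x l"
      using ex_least_nat_le[of "\<lambda>m. s < x m" n] st x by auto
    then obtain l where l: "m = Suc l"
      using st x by (cases m) auto
    have "0 < u l {s..t}"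
      unfolding u_Icc using m l st x(3)[of l] by (simp add: not_less)
    moreover have "0 \<le> u l {s..t}" if "l < n" for l
      using valuation_nonneg[OF u[OF that]] st by simp
    ultimately show ?thesis
      unfolding v_def using m l by (intro sum_pos2[of _ l]) auto
  qed
  let ?V = "\<lambda>_ :: nat. v"
  have set: "setting n k ?V"
    using k v by (simp add: setting_def)
  interpret moving_knife \<tau> n k "truthful_profile n ?V"
    by (rule moving_knife_truthful_profile) fact+
  have slice: "v {knife m..knife (Suc m)} = mean v m" if "m < n" for m
    using that by (intro slice_eq_mean[OF v]) (simp_all add: truthful_profile_def)
  have knife: "knife m = x m" if "m < n" for m
  proof -
    have "mean v m = mean v 0"
      using slice that by (intro mean_const[OF v]) auto
    also have "\<dots> = 1"
      using v_x[of 0] x k by (simp add: start_def)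
    finally have "v {knife m..1} = real (n - m)"
      using that by (simp add: divide_eq_1_iff del: of_nat_diff)
    then have eq: "v {knife m..1} = v {x m..1}"
      using v_x[of m] that by simp
    have "0 \<le> knife m" "knife m \<le> 1" "0 \<le> x m" "x m \<le> 1"
      using knife_range[of m] x_range[of m] that by auto
    then have "\<not> knife m < x m" "\<not> x m < knife m"
      using eq v_pos[of "knife m" "x m"] v_pos[of "x m" "knife m"]
        valuation_split[OF v, of "knife m" "x m" 1] valuation_split[OF v, of "x m" "knife m" 1]
      by linarith+
    then show ?thesis
      by simp
  qed
  have knife_Suc: "knife (Suc m) = x (Suc m)" if "m < n" for m
    using that knife[of "Suc m"] knife_last x by (cases "Suc m = n") auto
  have "bij_betw dep {..<n} {..<n}"
    by (rule bij_betw_byWitness[of _ winner])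
      (use winner_dep dep_winner dep_less winner_present in \<open>auto simp: present_def\<close>)
  moreover have "share (outcome \<tau> n k ?V) i = {x (dep i)..x (Suc (dep i))}" if "i < n" for i
    using share_eq[OF that] knife knife_Suc dep_less[OF that] by (simp add: outcome_def)
  ultimately show "\<exists>V \<pi>. (\<forall>i<n. valuation (V i)) \<and> bij_betw \<pi> {..<n} {..<n} \<and>
      (\<forall>i<n. share (outcome \<tau> n k V) i = {x (\<pi> i)..x (Suc (\<pi> i))})"
    using v by (intro exI[of _ ?V] exI[of _ dep]) blast
qed

section \<open>Counterexamples\<close>

text \<open>A strictly earliest caller is the only caller, so every tie rule picks the same winner;
  hence the counterexamples work for all tie rules.\<close>

lemma next_round_unique_earliest:
  assumes "tie_rule \<tau>" and i: "i \<in> present n k h"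
    and less: "\<And>j. j \<in> present n k h \<Longrightarrow> j \<noteq> i \<Longrightarrow> S i h < S j h"
    and "\<not> is_singleton (present n k h)"
  shows "next_round \<tau> n k S h = Round {i} i (S i h)"
proof -
  have fin: "finite (present n k h)"
    by (simp add: present_def)
  have Min: "Min ((\<lambda>i. S i h) ` present n k h) = S i h"
    using i less fin by (intro Min_eqI) (force simp: less_imp_le)+
  have "{j \<in> present n k h. S j h = S i h} = {i}"
    using i less by force
  moreover have "\<tau> (present n k h) {i} = i"
    using assms(1)[unfolded tie_rule_def, rule_format, of "present n k h" "{i}"] i fin by simp
  ultimately show ?thesis
    using assms(4) Min by (simp add: next_round_def Let_def)
qed

text \<open>The smallest admissible case. Player \<open>q\<close> loses the opening round and meets
  the newcomer 2; \<open>a\<close> is the earlier caller of these two, and \<open>b\<close> is left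
  with the remainder.\<close>

lemma play_3_2:
  assumes tie: "tie_rule \<tau>"
    and pq: "{p, q} = {0, 1}" "p \<noteq> q" "S p [] < S q []"
    and ab: "{a, b} = {q, 2}" "a \<noteq> b"
      "S a [Round {p} p (S p [])] < S b [Round {p} p (S p [])]"
  shows "play \<tau> 3 2 S =
    [Round {p} p (S p []), Round {a} a (S a [Round {p} p (S p [])]), Round {b} b 1]"
proof -
  let ?h1 = "[Round {p} p (S p [])]"
  let ?h2 = "?h1 @ [Round {a} a (S a ?h1)]"
  have two: "{..<2} = {p, q}"
    unfolding pq(1) by (simp add: numeral_2_eq_2 lessThan_Suc insert_commute)
  have "{..<3} = insert 2 {p, q}"
    unfolding pq(1) by (simp add: numeral_3_eq_3 numeral_2_eq_2 lessThan_Suc insert_commute)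
  then have three: "{..<3} = insert p {a, b}"
    unfolding ab(1) by blast
  have "p \<in> {0, 1}"
    using pq(1) by blast
  then have "p \<noteq> 2"
    by auto
  then have "p \<notin> {a, b}"
    unfolding ab(1) using pq(2) by simp
  then have pres: "present 3 2 [] = {p, q}" "present 3 2 ?h1 = {a, b}" "present 3 2 ?h2 = {b}"
    using two three ab(2) by (auto simp: present_def)
  have "next_round \<tau> 3 2 S [] = Round {p} p (S p [])"
    by (rule next_round_unique_earliest[OF tie]) (use pres pq in \<open>auto simp: is_singleton_def\<close>)
  moreover have "next_round \<tau> 3 2 S ?h1 = Round {a} a (S a ?h1)"
    by (rule next_round_unique_earliest[OF tie]) (use pres ab in \<open>auto simp: is_singleton_def\<close>)
  moreover have "next_round \<tau> 3 2 S ?h2 = Round {b} b 1"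
    unfolding next_round_def pres Let_def by simp
  ultimately show ?thesis
    by (simp add: numeral_3_eq_3 rounds.simps(2))
qed

lemma departure_3:
  assumes "distinct [taker r, taker s, taker t]"
  shows "departure [r, s, t] (taker r) = 0" "departure [r, s, t] (taker s) = 1"
    "departure [r, s, t] (taker t) = 2"
  using assms unfolding departure_def
  by (auto intro!: the_equality simp: less_Suc_eq numeral_2_eq_2)

lemma share_3:
  assumes "distinct [p, a, b]"
  shows "share [Round A p x, Round B a y, Round C b z] p = {0..x}"
    "share [Round A p x, Round B a y, Round C b z] a = {x..y}"
    "share [Round A p x, Round B a y, Round C b z] b = {y..z}"
  using departure_3[of "Round A p x" "Round B a y" "Round C b z"] assms
  by (simp_all add: share_def slice_def start_def numeral_2_eq_2)

section \<open>Densities for the examples and the resulting calls\<close>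

definition val_all :: "real set \<Rightarrow> real" where
  "val_all P = 1 * measure lebesgue (P \<inter> {0..1})"

definition val_left :: "real set \<Rightarrow> real" where
  "val_left P = 3 * measure lebesgue (P \<inter> {0..1/3})"

definition val_right :: "real set \<Rightarrow> real" where
  "val_right P = 3 * measure lebesgue (P \<inter> {2/3..1})"

text \<open>Mass 8 on the left third and mass 1 on \<open>{2/3..3/4}\<close>: only a ninth of the
  value is left once the left third is gone.\<close>

definition val_two :: "real set \<Rightarrow> real" where
  "val_two P = 24 * measure lebesgue (P \<inter> {0..1/3}) + 12 * measure lebesgue (P \<inter> {2/3..3/4})"

lemma val_Icc:
  "val_all {s..t} = max 0 (min t 1 - max s 0)"
  "val_left {s..t} = 3 * max 0 (min t (1/3) - max s 0)"
  "val_right {s..t} = 3 * max 0 (min t 1 - max s (2/3))"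
  "val_two {s..t} = 24 * max 0 (min t (1/3) - max s 0) + 12 * max 0 (min t (3/4) - max s (2/3))"
  unfolding val_all_def val_left_def val_right_def val_two_def uniform_Icc by simp_all

lemma valuation_val:
  "valuation val_all" "valuation val_left" "valuation val_right" "valuation val_two"
  unfolding val_all_def[abs_def] val_left_def[abs_def] val_right_def[abs_def] val_two_def[abs_def]
  by (intro valuation_add valuation_uniform; simp)+

lemma first_calls:
  "truthful_strat 3 val_all [] = 1/3"
  "truthful_strat 3 val_left [] = 1/9"
  "truthful_strat 3 val_right [] = 7/9"
  by (rule truthful_strat_eqI; auto simp: val_Icc start_def max_def min_def
      simp del: atLeastAtMost_singleton)+

text \<open>With two players to serve, each call halves the remaining value. For
  \<open>val_left\<close> nothing remains after a cut at 1/3, so the call comes at once. The cut at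
  2/3 belongs to the deviation in \<open>not_truthful\<close>.\<close>

lemma second_calls:
  "truthful_strat 3 val_all [Round C i (1/9)] = 5/9"
  "truthful_strat 3 val_right [Round C i (1/9)] = 5/6"
  "truthful_strat 3 val_left [Round C i (1/3)] = 1/3"
  "truthful_strat 3 val_right [Round C i (1/3)] = 5/6"
  "truthful_strat 3 val_two [Round C i (1/3)] = 17/24"
  "truthful_strat 3 val_right [Round C i (2/3)] = 5/6"
  "truthful_strat 3 val_two [Round C i (2/3)] = 17/24"
  by (rule truthful_strat_eqI; auto simp: val_Icc start_def max_def min_def
      simp del: atLeastAtMost_singleton)+

section \<open>Three-player profiles refuting the other properties\<close>

lemma setting_3_2:
  assumes "valuation u" "valuation v" "valuation w"
  shows "setting 3 2 ((!) [u, v, w])"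
  using assms by (simp add: setting_def numeral_3_eq_3 All_less_Suc)

text \<open>Player 0 leaves with the left third, which player 2 values most; player 2 then calls at
  17/24, before the call of player 1 at 5/6. This profile serves all refutations except that of
  order monotonicity.\<close>

lemma outcome_3_2:
  assumes "tie_rule \<tau>"
  shows "outcome \<tau> 3 2 ((!) [val_all, val_right, val_two]) =
    [Round {0} 0 (1/3), Round {2} 2 (17/24), Round {1} 1 1]"
  unfolding outcome_def
  by (subst play_3_2[OF assms, of 0 1 _ 2 1])
    (auto simp: truthful_profile_def first_calls second_calls)

lemma shares_3_2:
  assumes "tie_rule \<tau>"
  defines "H \<equiv> outcome \<tau> 3 2 ((!) [val_all, val_right, val_two])"
  shows "share H 0 = {0..1/3}" "share H 1 = {17/24..1}" "share H 2 = {1/3..17/24}"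
    "departure H 2 = 1"
  unfolding H_def outcome_3_2[OF assms(1)]
  using share_3[of 0 2 1] departure_3[of "Round {0} 0 (1/3)" "Round {2} 2 (17/24)" "Round {1} 1 1"]
  by simp_all

text \<open>Player 2 receives value 1/2 out of a total of 9.\<close>

lemma not_proportional:
  assumes "tie_rule \<tau>"
  shows "\<not> proportional \<tau>"
proof
  assume "proportional \<tau>"
  from this[unfolded proportional_def, rule_format, OF setting_3_2[OF valuation_val(1,3,4)], of 2]
  show False
    by (simp add: shares_3_2[OF assms] val_Icc)
qed

text \<open>Player 0 gets length 1/3, whereas player 2 later takes length 3/8.\<close>

lemma not_forward_envy_free:
  assumes "tie_rule \<tau>"
  shows "\<not> forward_envy_free \<tau>"
proof
  assume "forward_envy_free \<tau>"
  from this[unfolded forward_envy_free_def Let_def, rule_format,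
      OF setting_3_2[OF valuation_val(1,3,4)], of 0 2]
  show False
    by (simp add: shares_3_2[OF assms] val_Icc arrival_def)
qed

lemma not_envy_free:
  assumes "tie_rule \<tau>"
  shows "\<not> envy_free \<tau>"
  using not_forward_envy_free[OF assms]
  unfolding envy_free_def forward_envy_free_def Let_def by blast

lemma not_equitable:
  assumes "tie_rule \<tau>"
  shows "\<not> equitable \<tau>"
proof
  assume "equitable \<tau>"
  from this[unfolded equitable_def Let_def, rule_format,
      OF setting_3_2[OF valuation_val(1,3,4)], of 0 2]
  show False
    by (simp add: shares_3_2[OF assms] val_Icc)
qed

lemma not_weakly_pareto_optimal:
  assumes "tie_rule \<tau>"
  shows "\<not> weakly_pareto_optimal \<tau>"
proof
  let ?V = "(!) [val_all, val_right, val_two]"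
  \<comment> \<open>Giving the left third to player 2 frees the middle: player 0 gets length 17/48
    instead of 1/3, and the piece of player 1 now starts at 11/16 instead of 17/24.\<close>
  let ?Q = "(!) [{1/3..11/16}, {11/16..1}, {0..1/3 :: real}]"
  assume "weakly_pareto_optimal \<tau>"
  moreover have "allocation 3 ?Q"
    unfolding allocation_def
    by (auto simp: numeral_3_eq_3 All_less_Suc intro!: piece_Icc)
  moreover have "\<forall>i<3. ?V i (share (outcome \<tau> 3 2 ?V) i) < ?V i (?Q i)"
    using shares_3_2[OF assms]
    by (simp add: numeral_3_eq_3 All_less_Suc val_Icc numeral_2_eq_2)
  ultimately show False
    using setting_3_2[OF valuation_val(1,3,4)] unfolding weakly_pareto_optimal_def Let_def by blast
qed

text \<open>As there is at least one player, an allocation better for everybody is also a Pareto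
  improvement.\<close>

lemma not_pareto_optimal:
  assumes "tie_rule \<tau>"
  shows "\<not> pareto_optimal \<tau>"
proof
  assume po: "pareto_optimal \<tau>"
  have "weakly_pareto_optimal \<tau>"
    unfolding weakly_pareto_optimal_def Let_def
  proof (intro allI impI notI)
    fix n k and V :: "nat \<Rightarrow> real set \<Rightarrow> real"
    assume set: "setting n k V"
      and "\<exists>Q. allocation n Q \<and> (\<forall>i<n. V i (share (outcome \<tau> n k V) i) < V i (Q i))"
    then obtain Q where Q: "allocation n Q" "\<forall>i<n. V i (share (outcome \<tau> n k V) i) < V i (Q i)"
      by blast
    have "0 < n"
      using set by (simp add: setting_def)
    then show False
      using po[unfolded pareto_optimal_def Let_def, rule_format, OF set] Q less_imp_le by blast
  qed
  then show False
    using not_weakly_pareto_optimal[OF assms] by blast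
qed

lemma not_truthful:
  assumes "tie_rule \<tau>"
  shows "\<not> truthful \<tau>"
proof
  let ?V = "(!) [val_all, val_right, val_two]"
  \<comment> \<open>Player 0 can wait until 2/3 because player 1 first calls at 7/9; the value 1 is
    a legal call after any other history.\<close>
  define \<sigma> :: strat where "\<sigma> h = (if h = [] then 2/3 else 1)" for h
  assume "truthful \<tau>"
  moreover have "strategy \<sigma>"
    by (auto simp: strategy_def \<sigma>_def start_def)
  moreover have "play \<tau> 3 2 ((truthful_profile 3 ?V)(0 := \<sigma>)) =
      [Round {0} 0 (2/3), Round {2} 2 (17/24), Round {1} 1 1]"
    by (subst play_3_2[OF assms, of 0 1 _ 2 1])
      (auto simp: truthful_profile_def \<sigma>_def first_calls second_calls)
  then have "?V 0 (share (outcome \<tau> 3 2 ?V) 0)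
      < ?V 0 (share (play \<tau> 3 2 ((truthful_profile 3 ?V)(0 := \<sigma>))) 0)"
    using share_3(1)[of 0 2 1] shares_3_2[OF assms] by (simp add: val_Icc)
  ultimately show False
    using setting_3_2[OF valuation_val(1,3,4)] zero_less_numeral[of "num.Bit1 num.One"]
    unfolding truthful_def by blast
qed

text \<open>Arriving last, the uniform player comes after the \<open>val_left\<close> player has
  left with only 1/9, and gets half of the rest, 4/9. One position earlier it meets the
  \<open>val_right\<close> player in the opening round and leaves with 1/3.\<close>

lemma not_order_monotonic:
  assumes "tie_rule \<tau>"
  shows "\<not> order_monotonic \<tau>"
proof
  let ?V = "(!) [val_right, val_left, val_all]"
  let ?W = "move_earlier 2 1 ?V"
  have W: "?W 0 = val_right" "?W 1 = val_all" "?W 2 = val_left"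
    by (simp_all add: move_earlier_def)
  have V_share: "share (outcome \<tau> 3 2 ?V) 2 = {1/9..5/9}"
    unfolding outcome_def
    by (subst play_3_2[OF assms, of 1 0 _ 2 0])
      (auto simp: truthful_profile_def first_calls second_calls share_3(2)[of 1 2 0, simplified])
  have W_share: "share (outcome \<tau> 3 2 ?W) 1 = {0..1/3}"
    unfolding outcome_def
    by (subst play_3_2[OF assms, of 1 0 _ 2 0])
      (auto simp: truthful_profile_def W[unfolded One_nat_def] first_calls second_calls
        share_3(1)[of 1 2 0, simplified])
  assume "order_monotonic \<tau>"
  from this[unfolded order_monotonic_def, rule_format,
      OF setting_3_2[OF valuation_val(3,2,1)], of 2 1]
  show False
    unfolding V_share W_share by (simp add: val_Icc)
qed

theorem theorem4:
  fixes \<tau> :: tie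
  assumes "tie_rule \<tau>"
  shows "forward_proportional \<tau> \<and> immediately_envy_free \<tau> \<and> weakly_truthful \<tau> \<and>
         surjective \<tau> \<and> scale_invariant \<tau> \<and> sequential \<tau> \<and>
         \<not> proportional \<tau> \<and> \<not> envy_free \<tau> \<and> \<not> forward_envy_free \<tau> \<and> \<not> equitable \<tau> \<and>
         \<not> pareto_optimal \<tau> \<and> \<not> weakly_pareto_optimal \<tau> \<and> \<not> truthful \<tau> \<and> \<not> order_monotonic \<tau>"
  using forward_proportional_moving_knife[OF assms] immediately_envy_free_moving_knife[OF assms]
    weakly_truthful_moving_knife[OF assms] surjective_moving_knife[OF assms]
    scale_invariant_moving_knife sequential_moving_knife[OF assms] not_proportional[OF assms]
    not_envy_free[OF assms] not_forward_envy_free[OF assms] not_equitable[OF assms]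
    not_pareto_optimal[OF assms] not_weakly_pareto_optimal[OF assms] not_truthful[OF assms]
    not_order_monotonic[OF assms]
  by blast

end
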